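(* Let $m,n,k,l,N$ be positive integers and let $A\in\mathbb{Z}^{l\times m}$, $T\in\mathbb{Z}^{k\times m}$, $W\in\mathbb{Z}^{k\times n}$ be integer matrices. Let $\Gamma_N\subseteq\mathbb{Z}^{m+Nn}$ be the Graver basis of the $N$-scenario stochastic integer program $$\min\Big\{c^\top x+\sum_{i=1}^N p_i q_i^\top y_i : Ax=b,\ x\in\mathbb{Z}_{+}^m,\ Tx+Wy_i=h_i,\ y_i\in\mathbb{Z}_{+}^n \text{ for } i=1,\dots,N\Big\},$$ that is, the Graver basis of its coefficient matrix $$A_N=\begin{pmatrix} A & 0 & 0 & \cdots & 0\\ T & W & 0 & \cdots & 0\\ T & 0 & W & \cdots & 0\\ \vdots & \vdots & \vdots & \ddots & \vdots\\ T & 0 & 0 & \cdots & W\end{pmatrix}$$ (with $N$ block rows containing $T$), and let $\Gamma_1\subseteq\mathbb{Z}^{m+n}$ be the Graver basis of the corresponding single-scenario integer program $$\min\big\{c^\top x+p\,q^\top y : Ax=b,\ x\in\mathbb{Z}_{+}^m,\ Tx+Wy=h,\ y\in\mathbb{Z}_{+}^n\big\},$$ that is, the Graver basis of its coefficient matrix $$A_1=\begin{pmatrix} A & 0\\ T & W\end{pmatrix}.$$ If $\operatorname{Ker}_{\mathbb{R}}(A)=\{u\in\mathbb{R}^m: Au=0\}=\{0\}$, then $$\Gamma_N=\big\{(0,0,\dots,0,v_i,0,\dots,0) : i\in\{1,\dots,N\},\ v_i\in\mathbb{Z}^n,\ (0,v_i)\in\Gamma_1\big\},$$ where vectors of $\mathbb{Z}^{m+Nn}$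 are written in block form $(x,y_1,\dots,y_N)$ with $x\in\mathbb{Z}^m$ and $y_1,\dots,y_N\in\mathbb{Z}^n$, and in $(0,0,\dots,0,v_i,0,\dots,0)$ the vector $v_i$ occupies the block $y_i$ and all other blocks are zero.
   Context: For $a=(a_1,\dots,a_r),\ b=(b_1,\dots,b_r)\in\mathbb{Z}^r$, write $a\sqsubseteq b$ if $a_jb_j\ge 0$ and $|a_j|\le|b_j|$ for all $j=1,\dots,r$. For an integer matrix $M$ with $r$ columns, the Graver basis of $M$ is the set of $\sqsubseteq$-minimal elements of $\{u\in\mathbb{Z}^r : Mu=0,\ u\neq 0\}$. The Graver basis of an integer program means the Graver basis of the coefficient matrix of its equality constraints; it does not depend on the cost vectors $c,q,q_i$, the probabilities $p,p_i$ or the right-hand sides $b,h,h_i$. The set $\mathbb{Z}_{+}$ denotes the nonnegative integers. *)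

theory Defs
  imports "Jordan_Normal_Form.Matrix_Kernel"
begin

definition conformal_le :: "int vec \<Rightarrow> int vec \<Rightarrow> bool" (infix \<open>\<sqsubseteq>\<^sub>c\<close> 50) where
  "a \<sqsubseteq>\<^sub>c b \<longleftrightarrow> dim_vec a = dim_vec b \<and>
     (\<forall>j<dim_vec b. a $ j * b $ j \<ge> 0 \<and> \<bar>a $ j\<bar> \<le> \<bar>b $ j\<bar>)"

definition graver_basis :: "int mat \<Rightarrow> int vec set" where
  "graver_basis M =
     {u \<in> mat_kernel M - {0\<^sub>v (dim_col M)}.
        \<forall>w \<in> mat_kernel M - {0\<^sub>v (dim_col M)}. w \<sqsubseteq>\<^sub>c u \<longrightarrow> w = u}"

text \<open>
  Coefficient matrix of the equality constraints of the \<open>N\<close>-scenario program: the lower left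
  block consists of \<open>N\<close> copies of \<open>T\<close> on top of each other.
\<close>

definition scenario_mat :: "nat \<Rightarrow> int mat \<Rightarrow> int mat \<Rightarrow> int mat \<Rightarrow> int mat" where
  "scenario_mat N A T W =
     four_block_mat
       A (0\<^sub>m (dim_row A) (N * dim_col W))
       (mat (N * dim_row T) (dim_col T) (\<lambda>(i, j). T $$ (i mod dim_row T, j)))
       (diag_block_mat (replicate N W))"

definition single_scenario_mat :: "int mat \<Rightarrow> int mat \<Rightarrow> int mat \<Rightarrow> int mat" where
  "single_scenario_mat A T W = four_block_mat A (0\<^sub>m (dim_row A) (dim_col W)) T W"

end

theory Submission
  imports Defs
begin

text \<open>
  If the real kernel of \<open>A\<close> is trivial, the first block row forces \<open>x = 0\<close> for every integer kernel
  vector of the scenario matrix. What remains of the kernel is the kernel of the block-diagonal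
  matrix \<open>W \<oplus> \<dots> \<oplus> W\<close>, which is a direct product. In a direct product of kernels every
  \<open>\<sqsubseteq>\<^sub>c\<close>-minimal nonzero vector lives in one factor only: setting one of the components of a
  kernel vector to zero gives a kernel vector below it. So the Graver basis of a direct sum is the
  union of the embedded Graver bases of the summands
  (\<open>append_in_graver_basis_direct_sum_iff\<close>), and induction on the number of
  summands gives the Graver basis of \<open>W \<oplus> \<dots> \<oplus> W\<close>.

  The reduction to the lower right block (\<open>graver_basis_injective_block\<close>) applies to the
  single-scenario matrix as well, and identifies its Graver basis with that of \<open>W\<close>.
\<close>

section \<open>The conformal order and kernels on appended vectors\<close>

lemma conformal_le_append_iff:
  assumes "dim_vec a = dim_vec c"
  shows "a @\<^sub>v b \<sqsubseteq>\<^sub>c c @\<^sub>v d \<longleftrightarrow> a \<sqsubseteq>\<^sub>c c \<and> b \<sqsubseteq>\<^sub>c d"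
proof
  assume le: "a @\<^sub>v b \<sqsubseteq>\<^sub>c c @\<^sub>v d"
  then have dims: "dim_vec b = dim_vec d" 
    and le': "\<And>j. j < dim_vec c + dim_vec d \<Longrightarrow>
      (a @\<^sub>v b) $ j * (c @\<^sub>v d) $ j \<ge> 0 \<and> \<bar>(a @\<^sub>v b) $ j\<bar> \<le> \<bar>(c @\<^sub>v d) $ j\<bar>"
    using assms by (auto simp: conformal_le_def)
  have "a $ j * c $ j \<ge> 0 \<and> \<bar>a $ j\<bar> \<le> \<bar>c $ j\<bar>" if "j < dim_vec c" for j
    using le'[of j] that assms dims by simp
  moreover have "b $ j * d $ j \<ge> 0 \<and> \<bar>b $ j\<bar> \<le> \<bar>d $ j\<bar>" if "j < dim_vec d" for j
    using le'[of "dim_vec c + j"] that assms dims by simp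
  ultimately show "a \<sqsubseteq>\<^sub>c c \<and> b \<sqsubseteq>\<^sub>c d"
    using assms dims by (simp add: conformal_le_def)
next
  assume "a \<sqsubseteq>\<^sub>c c \<and> b \<sqsubseteq>\<^sub>c d"
  then show "a @\<^sub>v b \<sqsubseteq>\<^sub>c c @\<^sub>v d"
    by (auto simp: conformal_le_def)
qed

lemma conformal_le_refl: "a \<sqsubseteq>\<^sub>c a"
  by (simp add: conformal_le_def)

lemma zero_conformal_le: "a \<in> carrier_vec n \<Longrightarrow> 0\<^sub>v n \<sqsubseteq>\<^sub>c a"
  by (auto simp: conformal_le_def)

lemma conformal_le_zero_iff: "a \<sqsubseteq>\<^sub>c 0\<^sub>v n \<longleftrightarrow> a = 0\<^sub>v n"
  by (auto simp: conformal_le_def)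

lemma append_vec_eq_zero_iff:
  assumes "v \<in> carrier_vec m" "w \<in> carrier_vec n"
  shows "v @\<^sub>v w = 0\<^sub>v (m + n) \<longleftrightarrow> v = 0\<^sub>v m \<and> w = 0\<^sub>v n"
proof -
  have "0\<^sub>v (m + n) = 0\<^sub>v m @\<^sub>v (0\<^sub>v n :: 'a :: zero vec)"
    by auto
  then show ?thesis
    using append_vec_eq[OF assms(1), of "0\<^sub>v m" w "0\<^sub>v n"] by simp
qed

lemma zero_mat_mult_vec:
  assumes "v \<in> carrier_vec c"
  shows "0\<^sub>m r c *\<^sub>v v = 0\<^sub>v r"
  using assms by (intro eq_vecI) auto

lemma mat_mult_zero_vec:
  assumes "M \<in> carrier_mat r c"
  shows "M *\<^sub>v 0\<^sub>v c = 0\<^sub>v r"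
  using assms by (intro eq_vecI) auto

lemma in_kernel_iff:
  assumes "M \<in> carrier_mat r c"
  shows "u \<in> mat_kernel M \<longleftrightarrow> u \<in> carrier_vec c \<and> M *\<^sub>v u = 0\<^sub>v r"
  using assms by (auto simp: mat_kernel_def)

lemma in_graver_basis_iff:
  assumes "M \<in> carrier_mat r c"
  shows "u \<in> graver_basis M \<longleftrightarrow> u \<in> mat_kernel M \<and> u \<noteq> 0\<^sub>v c \<and>
    (\<forall>w \<in> mat_kernel M. w \<noteq> 0\<^sub>v c \<longrightarrow> w \<sqsubseteq>\<^sub>c u \<longrightarrow> w = u)"
  using assms by (auto simp: graver_basis_def)

lemma graver_basis_carrier:
  assumes "M \<in> carrier_mat r c" and "u \<in> graver_basis M"
  shows "u \<in> carrier_vec c"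
  using assms by (simp add: in_graver_basis_iff in_kernel_iff)

section \<open>Graver bases of block matrices\<close>

lemma append_in_kernel_lower_block_iff:
  assumes "C \<in> carrier_mat r1 c1" "T \<in> carrier_mat r2 c1" "D \<in> carrier_mat r2 c2"
    and "v \<in> carrier_vec c1" "w \<in> carrier_vec c2"
  shows "v @\<^sub>v w \<in> mat_kernel (four_block_mat C (0\<^sub>m r1 c2) T D) \<longleftrightarrow>
    C *\<^sub>v v = 0\<^sub>v r1 \<and> T *\<^sub>v v + D *\<^sub>v w = 0\<^sub>v r2"
proof -
  have F: "four_block_mat C (0\<^sub>m r1 c2) T D \<in> carrier_mat (r1 + r2) (c1 + c2)"
    using assms by simp
  have "four_block_mat C (0\<^sub>m r1 c2) T D *\<^sub>v (v @\<^sub>v w) = 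
      (C *\<^sub>v v) @\<^sub>v (T *\<^sub>v v + D *\<^sub>v w)"
    using assms by (simp add: four_block_mat_mult_vec[of _ r1 c1 _ c2 _ r2] zero_mat_mult_vec)
  then show ?thesis
    unfolding in_kernel_iff[OF F] using assms 
    by (simp add: append_vec_eq_zero_iff)
qed

lemma vec_append_cases:
  assumes "u \<in> carrier_vec (a + b)"
  obtains v w where "u = v @\<^sub>v w" "v \<in> carrier_vec a" "w \<in> carrier_vec b"
  using assms vec_first_last_append[OF assms] vec_first_carrier vec_last_carrier by metis

text \<open>
  A kernel vector \<open>v @\<^sub>v w\<close> of the block matrix has \<open>v = 0\<close> by its upper rows, so its lower rows
  read \<open>D w = 0\<close>. Thus \<open>w \<mapsto> 0 @\<^sub>v w\<close> is a bijection from the kernel of \<open>D\<close> to that of the block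
  matrix; it preserves and reflects \<open>\<sqsubseteq>\<^sub>c\<close>, hence minimality.
\<close>

lemma graver_basis_injective_block:
  assumes C: "C \<in> carrier_mat r1 c1" and T: "T \<in> carrier_mat r2 c1" and D: "D \<in> carrier_mat r2 c2"
    and inj: "mat_kernel C = {0\<^sub>v c1}"
  shows "graver_basis (four_block_mat C (0\<^sub>m r1 c2) T D) = (\<lambda>w. 0\<^sub>v c1 @\<^sub>v w) ` graver_basis D"
proof -
  let ?F = "four_block_mat C (0\<^sub>m r1 c2) T D"
  have F: "?F \<in> carrier_mat (r1 + r2) (c1 + c2)"
    using C D by simp
  have ker: "mat_kernel ?F = (\<lambda>w. 0\<^sub>v c1 @\<^sub>v w) ` mat_kernel D"
  proof (intro Set.set_eqI iffI)
    fix u assume u: "u \<in> mat_kernel ?F"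
    then have "u \<in> carrier_vec (c1 + c2)"
      using F by (simp add: in_kernel_iff)
    then obtain v w where vw: "u = v @\<^sub>v w" "v \<in> carrier_vec c1" "w \<in> carrier_vec c2"
      by (rule vec_append_cases)
    with u have eqs: "C *\<^sub>v v = 0\<^sub>v r1" "T *\<^sub>v v + D *\<^sub>v w = 0\<^sub>v r2"
      using append_in_kernel_lower_block_iff[OF C T D] by auto
    have "v \<in> mat_kernel C"
      unfolding in_kernel_iff[OF C] using vw(2) eqs(1) ..
    then have "v = 0\<^sub>v c1"
      using inj by simp
    moreover from this have "w \<in> mat_kernel D"
      using eqs(2) T D vw by (simp add: in_kernel_iff[OF D] mat_mult_zero_vec[OF T])
    ultimately show "u \<in> (\<lambda>w. 0\<^sub>v c1 @\<^sub>v w) ` mat_kernel D"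
      using vw by blast
  next
    fix u assume "u \<in> (\<lambda>w. 0\<^sub>v c1 @\<^sub>v w) ` mat_kernel D"
    then show "u \<in> mat_kernel ?F"
      using append_in_kernel_lower_block_iff[OF C T D] mat_mult_zero_vec[OF C] mat_mult_zero_vec[OF T]
      by (auto simp: in_kernel_iff[OF D])
  qed
  have "0\<^sub>v c1 @\<^sub>v w \<in> graver_basis ?F \<longleftrightarrow> w \<in> graver_basis D" if "w \<in> mat_kernel D" for w
  proof -
    have carr: "\<And>w. w \<in> mat_kernel D \<Longrightarrow> w \<in> carrier_vec c2"
      using D by (simp add: in_kernel_iff)
    show ?thesis
      unfolding in_graver_basis_iff[OF F] in_graver_basis_iff[OF D] ker using that
      by (auto simp: append_vec_eq_zero_iff carr conformal_le_append_iff conformal_le_refl 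
          append_vec_eq[OF zero_carrier_vec zero_carrier_vec])
  qed
  moreover have "graver_basis ?F \<subseteq> (\<lambda>w. 0\<^sub>v c1 @\<^sub>v w) ` mat_kernel D" "graver_basis D \<subseteq> mat_kernel D"
    using F D by (auto simp: in_graver_basis_iff simp flip: ker)
  ultimately show ?thesis
    by blast
qed

text \<open>
  The kernel of a direct sum is the product of the two kernels. If both parts of \<open>v @\<^sub>v w\<close> are
  nonzero, then \<open>v @\<^sub>v 0\<close> is a smaller nonzero kernel vector; and if one part is zero, so is that
  part of every kernel vector below, which leaves minimality in the other factor.
\<close>

lemma append_in_graver_basis_direct_sum_iff:
  assumes C: "C \<in> carrier_mat r1 c1" and D: "D \<in> carrier_mat r2 c2"
    and v: "v \<in> carrier_vec c1" and w: "w \<in> carrier_vec c2"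
  shows "v @\<^sub>v w \<in> graver_basis (four_block_mat C (0\<^sub>m r1 c2) (0\<^sub>m r2 c1) D) \<longleftrightarrow>
    v \<in> graver_basis C \<and> w = 0\<^sub>v c2 \<or> v = 0\<^sub>v c1 \<and> w \<in> graver_basis D"
    (is "_ \<in> graver_basis ?F \<longleftrightarrow> _")
proof -
  have F: "?F \<in> carrier_mat (r1 + r2) (c1 + c2)"
    using C D by simp
  have ker: "v @\<^sub>v w \<in> mat_kernel ?F \<longleftrightarrow> v \<in> mat_kernel C \<and> w \<in> mat_kernel D"
    if "v \<in> carrier_vec c1" "w \<in> carrier_vec c2" for v w
    using that C D append_in_kernel_lower_block_iff[OF C zero_carrier_mat D that]
    by (simp add: in_kernel_iff zero_mat_mult_vec)
  have carrC: "\<And>v. v \<in> mat_kernel C \<Longrightarrow> v \<in> carrier_vec c1"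
    using C by (simp add: in_kernel_iff)
  have carrD: "\<And>w. w \<in> mat_kernel D \<Longrightarrow> w \<in> carrier_vec c2"
    using D by (simp add: in_kernel_iff)
  have zeros: "0\<^sub>v c1 \<in> mat_kernel C" "0\<^sub>v c2 \<in> mat_kernel D"
    using C D by (auto simp: in_kernel_iff)
  have all_kernel: "(\<forall>u \<in> mat_kernel ?F. P u) \<longleftrightarrow> (\<forall>v \<in> mat_kernel C. \<forall>w \<in> mat_kernel D. P (v @\<^sub>v w))"
    for P
  proof
    assume P: "\<forall>v \<in> mat_kernel C. \<forall>w \<in> mat_kernel D. P (v @\<^sub>v w)"
    show "\<forall>u \<in> mat_kernel ?F. P u"
    proof
      fix u assume u: "u \<in> mat_kernel ?F"
      then have "u \<in> carrier_vec (c1 + c2)"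
        using F by (simp add: in_kernel_iff)
      then obtain v w where "u = v @\<^sub>v w" "v \<in> carrier_vec c1" "w \<in> carrier_vec c2"
        by (rule vec_append_cases)
      then show "P u"
        using P u ker by blast
    qed
  qed (use ker carrC carrD in blast)
  have graver: "v @\<^sub>v w \<in> graver_basis ?F \<longleftrightarrow>
      v \<in> mat_kernel C \<and> w \<in> mat_kernel D \<and> \<not> (v = 0\<^sub>v c1 \<and> w = 0\<^sub>v c2) \<and>
      (\<forall>v' \<in> mat_kernel C. \<forall>w' \<in> mat_kernel D. \<not> (v' = 0\<^sub>v c1 \<and> w' = 0\<^sub>v c2) \<longrightarrow>
         v' \<sqsubseteq>\<^sub>c v \<longrightarrow> w' \<sqsubseteq>\<^sub>c w \<longrightarrow> v' = v \<and> w' = w)"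
  proof -
    have "v' @\<^sub>v w' \<noteq> 0\<^sub>v (c1 + c2) \<longleftrightarrow> \<not> (v' = 0\<^sub>v c1 \<and> w' = 0\<^sub>v c2)"
      "v' @\<^sub>v w' \<sqsubseteq>\<^sub>c v @\<^sub>v w \<longleftrightarrow> v' \<sqsubseteq>\<^sub>c v \<and> w' \<sqsubseteq>\<^sub>c w"
      "v' @\<^sub>v w' = v @\<^sub>v w \<longleftrightarrow> v' = v \<and> w' = w"
      if "v' \<in> mat_kernel C" "w' \<in> mat_kernel D" for v' w'
      using carrC[OF that(1)] carrD[OF that(2)] v w
      by (simp_all add: append_vec_eq_zero_iff conformal_le_append_iff append_vec_eq[of _ c1])
    then show ?thesis
      by (simp add: in_graver_basis_iff[OF F] all_kernel ker[OF v w] append_vec_eq_zero_iff[OF v w]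
          imp_conjL cong: ball_cong)
  qed
  show ?thesis
  proof
    assume "v @\<^sub>v w \<in> graver_basis ?F"
    then have vw: "v \<in> mat_kernel C" "w \<in> mat_kernel D" "\<not> (v = 0\<^sub>v c1 \<and> w = 0\<^sub>v c2)"
      and min: "\<And>v' w'. v' \<in> mat_kernel C \<Longrightarrow> w' \<in> mat_kernel D \<Longrightarrow>
        \<not> (v' = 0\<^sub>v c1 \<and> w' = 0\<^sub>v c2) \<Longrightarrow> v' \<sqsubseteq>\<^sub>c v \<Longrightarrow> w' \<sqsubseteq>\<^sub>c w \<Longrightarrow> v' = v \<and> w' = w"
      unfolding graver by blast+
    have "v = 0\<^sub>v c1 \<or> w = 0\<^sub>v c2"
      using min[of v "0\<^sub>v c2"] vw zeros conformal_le_refl zero_conformal_le[OF w] by auto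
    moreover have "v \<in> graver_basis C" if "w = 0\<^sub>v c2"
      using vw min[of _ w] that conformal_le_refl by (auto simp: in_graver_basis_iff[OF C])
    moreover have "w \<in> graver_basis D" if "v = 0\<^sub>v c1"
      using vw min[of v] that conformal_le_refl by (auto simp: in_graver_basis_iff[OF D])
    ultimately show "v \<in> graver_basis C \<and> w = 0\<^sub>v c2 \<or> v = 0\<^sub>v c1 \<and> w \<in> graver_basis D"
      by blast
  next
    assume "v \<in> graver_basis C \<and> w = 0\<^sub>v c2 \<or> v = 0\<^sub>v c1 \<and> w \<in> graver_basis D"
    then show "v @\<^sub>v w \<in> graver_basis ?F"
    proof (elim disjE conjE)
      assume "v \<in> graver_basis C" and w0: "w = 0\<^sub>v c2"
      then have "v \<in> mat_kernel C" "v \<noteq> 0\<^sub>v c1"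
        "\<forall>v' \<in> mat_kernel C. v' \<noteq> 0\<^sub>v c1 \<longrightarrow> v' \<sqsubseteq>\<^sub>c v \<longrightarrow> v' = v"
        by (simp_all add: in_graver_basis_iff[OF C])
      then show ?thesis
        unfolding graver unfolding w0 conformal_le_zero_iff using zeros by blast
    next
      assume "w \<in> graver_basis D" and v0: "v = 0\<^sub>v c1"
      then have "w \<in> mat_kernel D" "w \<noteq> 0\<^sub>v c2"
        "\<forall>w' \<in> mat_kernel D. w' \<noteq> 0\<^sub>v c2 \<longrightarrow> w' \<sqsubseteq>\<^sub>c w \<longrightarrow> w' = w"
        by (simp_all add: in_graver_basis_iff[OF D])
      then show ?thesis
        unfolding graver unfolding v0 conformal_le_zero_iff using zeros by blast
    qed
  qed
qed

section \<open>Repeated direct sums\<close>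

lemma diag_block_mat_replicate_carrier:
  assumes "W \<in> carrier_mat k n"
  shows "diag_block_mat (replicate N W) \<in> carrier_mat (N * k) (N * n)"
  using assms by (induction N) (auto simp: Let_def)

lemma zero_vecs_append_merge: "0\<^sub>v a @\<^sub>v 0\<^sub>v b @\<^sub>v v = 0\<^sub>v (a + b) @\<^sub>v v"
  by (rule eq_vecI) auto

text \<open>
  Splitting off the first summand: its Graver vectors are those with \<open>i = 1\<close>, and the others come
  from the remaining \<open>N\<close> summands by shifting \<open>i\<close> by one.
\<close>

lemma graver_basis_diag_replicate:
  fixes W :: "int mat"
  assumes W: "W \<in> carrier_mat k n"
  shows "graver_basis (diag_block_mat (replicate N W)) =
    {0\<^sub>v ((i - 1) * n) @\<^sub>v v @\<^sub>v 0\<^sub>v ((N - i) * n) | i v. i \<in> {1..N} \<and> v \<in> graver_basis W}"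
proof (induction N)
  case 0
  show ?case
    by (auto simp: graver_basis_def mat_kernel_def)
next
  case (Suc N)
  let ?D = "diag_block_mat (replicate N W)"
  let ?emb = "\<lambda>N i v. 0\<^sub>v ((i - 1) * n) @\<^sub>v v @\<^sub>v (0\<^sub>v ((N - i) * n) :: int vec)"
  let ?F = "four_block_mat W (0\<^sub>m k (N * n)) (0\<^sub>m (N * k) n) ?D"
  have D: "?D \<in> carrier_mat (N * k) (N * n)"
    using W by (rule diag_block_mat_replicate_carrier)
  have F: "?F \<in> carrier_mat (k + N * k) (n + N * n)"
    using W D by simp
  have F_eq: "diag_block_mat (replicate (Suc N) W) = ?F"
    using W D by (simp add: Let_def)
  have "graver_basis ?F = (\<lambda>v. v @\<^sub>v 0\<^sub>v (N * n)) ` graver_basis W \<union> (\<lambda>w. 0\<^sub>v n @\<^sub>v w) ` graver_basis ?D"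
  proof (intro Set.set_eqI iffI)
    fix u assume u: "u \<in> graver_basis ?F"
    obtain v w where "u = v @\<^sub>v w" "v \<in> carrier_vec n" "w \<in> carrier_vec (N * n)"
      using graver_basis_carrier[OF F u] by (rule vec_append_cases)
    then show "u \<in> (\<lambda>v. v @\<^sub>v 0\<^sub>v (N * n)) ` graver_basis W \<union> (\<lambda>w. 0\<^sub>v n @\<^sub>v w) ` graver_basis ?D"
      using u append_in_graver_basis_direct_sum_iff[OF W D] by auto
  next
    fix u assume "u \<in> (\<lambda>v. v @\<^sub>v 0\<^sub>v (N * n)) ` graver_basis W \<union> (\<lambda>w. 0\<^sub>v n @\<^sub>v w) ` graver_basis ?D"
    then show "u \<in> graver_basis ?F"
      using append_in_graver_basis_direct_sum_iff[OF W D]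
        graver_basis_carrier[OF W] graver_basis_carrier[OF D] by auto
  qed
  also have "(\<lambda>v. v @\<^sub>v 0\<^sub>v (N * n)) ` graver_basis W = {?emb (Suc N) 1 v | v. v \<in> graver_basis W}"
  proof -
    have "?emb (Suc N) 1 v = v @\<^sub>v 0\<^sub>v (N * n)" for v
      by auto
    then show ?thesis
      by auto
  qed
  also have "(\<lambda>w. 0\<^sub>v n @\<^sub>v w) ` graver_basis ?D =
      {?emb (Suc N) (Suc i) v | i v. i \<in> {1..N} \<and> v \<in> graver_basis W}"
  proof -
    have "0\<^sub>v n @\<^sub>v ?emb N i v = ?emb (Suc N) (Suc i) v" if "i \<in> {1..N}" for i v
      using that by (cases i) (auto simp: zero_vecs_append_merge)
    then have "{0\<^sub>v n @\<^sub>v ?emb N i v | i v. i \<in> {1..N} \<and> v \<in> graver_basis W} =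
        {?emb (Suc N) (Suc i) v | i v. i \<in> {1..N} \<and> v \<in> graver_basis W}"
      by (intro Collect_cong ex_cong1) auto
    then show ?thesis
      unfolding Suc.IH by blast
  qed
  also have "{?emb (Suc N) 1 v | v. v \<in> graver_basis W} \<union> \<dots> =
      {?emb (Suc N) i v | i v. i \<in> {1..Suc N} \<and> v \<in> graver_basis W}"
  proof -
    have "i \<in> {1..Suc N} \<longleftrightarrow> i = 1 \<or> (\<exists>j \<in> {1..N}. i = Suc j)" for i
      by (cases i) auto
    then show ?thesis
      by (simp only:) blast
  qed
  finally show ?case
    unfolding F_eq .
qed

section \<open>The scenario matrix\<close>

lemma kernel_int_trivial_if_real_trivial:
  assumes A: "A \<in> carrier_mat l m" and triv: "mat_kernel (map_mat real_of_int A) = {0\<^sub>v m}"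
  shows "mat_kernel A = {0\<^sub>v m}"
proof -
  have "v = 0\<^sub>v m" if v: "v \<in> carrier_vec m" "A *\<^sub>v v = 0\<^sub>v l" for v
  proof -
    have "map_mat real_of_int A *\<^sub>v map_vec real_of_int v = map_vec real_of_int (A *\<^sub>v v)"
      using A v(1) by (simp add: of_int_hom.mult_mat_vec_hom)
    also have "\<dots> = 0\<^sub>v l"
      using v(2) by auto
    finally have "map_vec real_of_int v \<in> mat_kernel (map_mat real_of_int A)"
      using A v(1) by (simp add: mat_kernel_def)
    then have "map_vec real_of_int v = 0\<^sub>v m"
      using triv by simp
    then show ?thesis
      using v(1) by (auto simp: vec_eq_iff)
  qed
  then show ?thesis
    using A by (auto simp: in_kernel_iff mat_mult_zero_vec)
qed

theorem theorem3p15: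
  fixes m n k l N :: nat and A T W :: "int mat"
  assumes "m > 0" and "n > 0" and "k > 0" and "l > 0" and "N > 0"
    and "A \<in> carrier_mat l m" and "T \<in> carrier_mat k m" and "W \<in> carrier_mat k n"
    and "mat_kernel (map_mat real_of_int A) = {0\<^sub>v m}"
  shows "graver_basis (scenario_mat N A T W) =
    {0\<^sub>v m @\<^sub>v 0\<^sub>v ((i - 1) * n) @\<^sub>v v @\<^sub>v 0\<^sub>v ((N - i) * n) | i v.
       i \<in> {1..N} \<and> v \<in> carrier_vec n \<and>
       0\<^sub>v m @\<^sub>v v \<in> graver_basis (single_scenario_mat A T W)}"
proof -
  note A = \<open>A \<in> carrier_mat l m\<close> and T = \<open>T \<in> carrier_mat k m\<close> and W = \<open>W \<in> carrier_mat k n\<close>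
  let ?D = "diag_block_mat (replicate N W)"
  have ker: "mat_kernel A = {0\<^sub>v m}"
    using assms by (intro kernel_int_trivial_if_real_trivial)
  have D: "?D \<in> carrier_mat (N * k) (N * n)"
    using W by (rule diag_block_mat_replicate_carrier)
  have "graver_basis (scenario_mat N A T W) = (\<lambda>w. 0\<^sub>v m @\<^sub>v w) ` graver_basis ?D"
    unfolding scenario_mat_def using A T W
    by (auto intro!: graver_basis_injective_block[OF A _ D ker])
  moreover have "graver_basis (single_scenario_mat A T W) = (\<lambda>w. 0\<^sub>v m @\<^sub>v w) ` graver_basis W"
    unfolding single_scenario_mat_def using A T W ker
    by (simp add: graver_basis_injective_block)
  then have "v \<in> carrier_vec n \<and> 0\<^sub>v m @\<^sub>v v \<in> graver_basis (single_scenario_mat A T W) \<longleftrightarrow>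
      v \<in> graver_basis W" for v
    using graver_basis_carrier[OF W]
    by (auto simp: append_vec_eq[OF zero_carrier_vec zero_carrier_vec])
  ultimately show ?thesis
    unfolding graver_basis_diag_replicate[OF W] by auto
qed

end
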